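(* Let $\mathcal{X}\subset\mathbb{R}^n$ be a convex compact polyhedral set, let $f:\mathbb{R}^n\to\mathbb{R}^n$ be an (unknown) vector field satisfying the componentwise Lipschitz bound $|f(x)-f(y)|\le M\|x-y\|_\infty$ for all $x,y\in\mathcal{X}$, where $M\in\mathbb{R}^n_{>0}$ is known, and let $\mathcal{D}_{N_d}=\{(x_i,f_i)\}_{i\in[N_d]}$ be an available data set with $x_i\in\mathcal{X}$ and $f_i=f(x_i)$. Then the uncertainty in the vector field induced by the data set can be characterized by the differential inclusion $$\dot x\in\mathbf{F}(x),\quad x\in\mathcal{X},$$ where $\mathbf{F}:\mathcal{X}\rightrightarrows\mathbb{R}^n$ is the set-valued map defined by $\mathbf{F}(x)=\mathbf{Q}_1(x)\times\cdots\times\mathbf{Q}_n(x)$. Moreover, the graph of $\mathbf{F}$ is represented by a finite union of polyhedral sets.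
   Context: The underlying dynamical system is $\dot x=f(x)$. Notation: $n,N_d$ are positive integers and $[m]=\{1,\dots,m\}$; $x_k$ is the $k$-th component of $x$, $x_{k,i}$ the $k$-th component of the data point $x_i$, $f_{\kappa,i}$ the $\kappa$-th component of $f_i$, $M_\kappa$ the $\kappa$-th component of $M$; $\mathbf{1}_n\in\mathbb{R}^n$ is the vector of ones; $|\cdot|$ and inequalities between vectors are componentwise. The graph of $\mathbf{F}$ is $\{(x,z)\in\mathcal{X}\times\mathbb{R}^n : z\in\mathbf{F}(x)\}$. The uncertainty set consistent with the data (the set of all admissible pairs of a state and a vector field value, given the data and the Lipschitz bound) is $$F_{\mathcal{D}_{N_d}}=\{(x,z)\in\mathcal{X}\times\mathbb{R}^n : \forall i\in[N_d],\ |z-f_i|\le M\|x-x_i\|_\infty\}.$$ For $i\in[N_d]$ and $\kappa,l\in[n]$ define $$P^{(+)}_{i,\kappa,l}=\left\{(x,z)\in\mathcal{X}\times\mathbb{R}: \left|\begin{matrix}x-x_i\\ z-f_{\kappa,i}\end{matrix}\right|\le\begin{bmatrix}\mathbf{1}_n\\ M_\kappa\end{bmatrix}(x_l-x_{l,i})\right\},$$ $$P^{(-)}_{i,\kappa,l}=\left\{(x,z)\in\mathcal{X}\times\mathbb{R}: \left|\begin{matrix}x-x_i\\ z-f_{\kappa,i}\end{matrix}\right|\le-\begin{bmatrix}\mathbf{1}_n\\ M_\kappa\end{bmatrix}(x_l-x_{l,i})\right\}.$$ Set $\mathbf{P}_{i,\kappa}=\bigcup_{l\in[n]}\big(P^{(+)}_{i,\kappa,l}\cup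 P^{(-)}_{i,\kappa,l}\big)$ and $Q_\kappa=\bigcap_{i\in[N_d]}\mathbf{P}_{i,\kappa}\subset\mathcal{X}\times\mathbb{R}$. For $x\in\mathcal{X}$, $\mathbf{Q}_\kappa(x)=\{z\in\mathbb{R}:(x,z)\in Q_\kappa\}$. *)

theory Defs
  imports "HOL-Analysis.Analysis"
begin

(* A data set with N points is given by functions xd, fd on the indices {1..N}.
   On real ^ 'n the operations abs and (\<le>) are componentwise and 1 is the vector of ones;
   infnorm is the maximum norm. *)

definition uncertainty_set ::
  "(real ^ 'n) set \<Rightarrow> real ^ 'n \<Rightarrow> nat \<Rightarrow> (nat \<Rightarrow> real ^ 'n) \<Rightarrow> (nat \<Rightarrow> real ^ 'n)
    \<Rightarrow> ((real ^ 'n) \<times> (real ^ 'n)) set" where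
  "uncertainty_set X M N xd fd =
     {(x, z). x \<in> X \<and> (\<forall>i\<in>{1..N}. \<bar>z - fd i\<bar> \<le> infnorm (x - xd i) *\<^sub>R M)}"

definition P_pos ::
  "(real ^ 'n) set \<Rightarrow> real ^ 'n \<Rightarrow> (nat \<Rightarrow> real ^ 'n) \<Rightarrow> (nat \<Rightarrow> real ^ 'n)
    \<Rightarrow> nat \<Rightarrow> 'n \<Rightarrow> 'n \<Rightarrow> ((real ^ 'n) \<times> real) set" where
  "P_pos X M xd fd i \<kappa> l =
     {(x, z). x \<in> X \<and> \<bar>x - xd i\<bar> \<le> (x $ l - xd i $ l) *\<^sub>R 1
        \<and> \<bar>z - fd i $ \<kappa>\<bar> \<le> M $ \<kappa> * (x $ l - xd i $ l)}"

definition P_neg ::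
  "(real ^ 'n) set \<Rightarrow> real ^ 'n \<Rightarrow> (nat \<Rightarrow> real ^ 'n) \<Rightarrow> (nat \<Rightarrow> real ^ 'n)
    \<Rightarrow> nat \<Rightarrow> 'n \<Rightarrow> 'n \<Rightarrow> ((real ^ 'n) \<times> real) set" where
  "P_neg X M xd fd i \<kappa> l =
     {(x, z). x \<in> X \<and> \<bar>x - xd i\<bar> \<le> - ((x $ l - xd i $ l) *\<^sub>R 1)
        \<and> \<bar>z - fd i $ \<kappa>\<bar> \<le> - (M $ \<kappa> * (x $ l - xd i $ l))}"

definition P_union ::
  "(real ^ 'n) set \<Rightarrow> real ^ 'n \<Rightarrow> (nat \<Rightarrow> real ^ 'n) \<Rightarrow> (nat \<Rightarrow> real ^ 'n)
    \<Rightarrow> nat \<Rightarrow> 'n \<Rightarrow> ((real ^ 'n) \<times> real) set" where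
  "P_union X M xd fd i \<kappa> = (\<Union>l. P_pos X M xd fd i \<kappa> l \<union> P_neg X M xd fd i \<kappa> l)"

definition Q_set ::
  "(real ^ 'n) set \<Rightarrow> real ^ 'n \<Rightarrow> nat \<Rightarrow> (nat \<Rightarrow> real ^ 'n) \<Rightarrow> (nat \<Rightarrow> real ^ 'n)
    \<Rightarrow> 'n \<Rightarrow> ((real ^ 'n) \<times> real) set" where
  "Q_set X M N xd fd \<kappa> = (\<Inter>i\<in>{1..N}. P_union X M xd fd i \<kappa>)"

definition Q_map ::
  "(real ^ 'n) set \<Rightarrow> real ^ 'n \<Rightarrow> nat \<Rightarrow> (nat \<Rightarrow> real ^ 'n) \<Rightarrow> (nat \<Rightarrow> real ^ 'n)
    \<Rightarrow> 'n \<Rightarrow> real ^ 'n \<Rightarrow> real set" where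
  "Q_map X M N xd fd \<kappa> x = {z. (x, z) \<in> Q_set X M N xd fd \<kappa>}"

definition F_map ::
  "(real ^ 'n) set \<Rightarrow> real ^ 'n \<Rightarrow> nat \<Rightarrow> (nat \<Rightarrow> real ^ 'n) \<Rightarrow> (nat \<Rightarrow> real ^ 'n)
    \<Rightarrow> real ^ 'n \<Rightarrow> (real ^ 'n) set" where
  "F_map X M N xd fd x = {z. \<forall>\<kappa>. z $ \<kappa> \<in> Q_map X M N xd fd \<kappa> x}"

definition graph_on :: "'a set \<Rightarrow> ('a \<Rightarrow> 'b set) \<Rightarrow> ('a \<times> 'b) set" where
  "graph_on X F = {(x, z). x \<in> X \<and> z \<in> F x}"

(* D ranges over finite families of non-overlapping subintervals [s, t] of [a, b]. *)
definition absolutely_continuous_curve ::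
  "real \<Rightarrow> real \<Rightarrow> (real \<Rightarrow> 'a::real_normed_vector) \<Rightarrow> bool" where
  "absolutely_continuous_curve a b \<phi> \<longleftrightarrow>
     (\<forall>\<epsilon>>0. \<exists>\<delta>>0. \<forall>D :: (real \<times> real) set.
        finite D \<and> (\<forall>(s, t)\<in>D. a \<le> s \<and> s \<le> t \<and> t \<le> b)
        \<and> pairwise (\<lambda>(s, t) (s', t'). t \<le> s' \<or> t' \<le> s) D
        \<and> (\<Sum>(s, t)\<in>D. t - s) < \<delta>
        \<longrightarrow> (\<Sum>(s, t)\<in>D. norm (\<phi> t - \<phi> s)) < \<epsilon>)"

(* Caratheodory solutions on [a, b] of: derivative of x in F(x), x in X.
   The differential equation with right-hand side f is the case F = (\<lambda>x. {f x}). *)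
definition solves_inclusion ::
  "'a::real_normed_vector set \<Rightarrow> ('a \<Rightarrow> 'a set) \<Rightarrow> real \<Rightarrow> real \<Rightarrow> (real \<Rightarrow> 'a) \<Rightarrow> bool" where
  "solves_inclusion X F a b \<phi> \<longleftrightarrow>
     absolutely_continuous_curve a b \<phi> \<and> (\<forall>t\<in>{a..b}. \<phi> t \<in> X)
     \<and> (AE t in lebesgue. t \<in> {a..b} \<longrightarrow>
          (\<exists>v\<in>F (\<phi> t). (\<phi> has_vector_derivative v) (at t)))"

end

theory Submission
  imports Defs
begin

text \<open>
  Since the maximum norm is attained at some component up to sign, \<open>P_union\<close> is exactly the
  set of pairs \<open>(x, z)\<close> with \<open>\<bar>z - f\<^sub>\<kappa>\<^sub>,\<^sub>i\<bar> \<le> M\<^sub>\<kappa> \<parallel>x - x\<^sub>i\<parallel>\<close>: each of its pieces fixes the active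
  component and its sign, on which the norm is linear. The graph is thus a finite intersection
  of linear preimages of finite unions of polyhedra.
\<close>

lemma infnorm_le_iff_cart: "infnorm (x :: real ^ 'n) \<le> c \<longleftrightarrow> (\<forall>j. \<bar>x $ j\<bar> \<le> c)"
proof
  assume "\<forall>j. \<bar>x $ j\<bar> \<le> c"
  then show "infnorm x \<le> c"
    unfolding infnorm_cart by (intro cSup_least) auto
qed (meson component_le_infnorm_cart order_trans)

text \<open>The index type is finite and nonempty, so the supremum of the absolute values is a
  maximum.\<close>

lemma infnorm_attained_cart: "\<exists>l. infnorm (x :: real ^ 'n) = \<bar>x $ l\<bar>"
proof -
  have "infnorm x = Max ((\<lambda>j. \<bar>x $ j\<bar>) ` UNIV)"
    unfolding infnorm_cart by (simp add: full_SetCompr_eq cSup_eq_Max)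
  also have "\<dots> \<in> (\<lambda>j. \<bar>x $ j\<bar>) ` UNIV"
    by (intro Max_in) auto
  finally show ?thesis
    by auto
qed

text \<open>Turns the vector inequality in the definition of the pieces into a bound on the norm;
  for negative \<open>c\<close> both sides are false.\<close>

lemma abs_le_scaled_one_iff:
  "\<bar>x :: real ^ 'n\<bar> \<le> c *\<^sub>R 1 \<longleftrightarrow> infnorm x \<le> c"
  by (simp add: less_eq_vec_def abs_vec_def infnorm_le_iff_cart)

text \<open>No component exceeds the maximum norm, so the inequality defining a piece already forces
  \<open>l\<close> to be an active component with positive sign.\<close>

lemma infnorm_le_component_iff: "infnorm (x :: real ^ 'n) \<le> x $ l \<longleftrightarrow> infnorm x = x $ l"
  using component_le_infnorm_cart[of x l] by linarith

lemma infnorm_le_neg_component_iff: "infnorm (x :: real ^ 'n) \<le> - x $ l \<longleftrightarrow> infnorm x = - x $ l"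
  using component_le_infnorm_cart[of x l] by linarith

lemma mem_P_pos_iff:
  "(x, z) \<in> P_pos X M xd fd i \<kappa> l \<longleftrightarrow>
     x \<in> X \<and> infnorm (x - xd i) = (x - xd i) $ l
       \<and> \<bar>z - fd i $ \<kappa>\<bar> \<le> M $ \<kappa> * infnorm (x - xd i)"
  using infnorm_le_component_iff[of "x - xd i" l]
  by (auto simp: P_pos_def abs_le_scaled_one_iff)

lemma mem_P_neg_iff:
  "(x, z) \<in> P_neg X M xd fd i \<kappa> l \<longleftrightarrow>
     x \<in> X \<and> infnorm (x - xd i) = - (x - xd i) $ l
       \<and> \<bar>z - fd i $ \<kappa>\<bar> \<le> M $ \<kappa> * infnorm (x - xd i)"
proof -
  have "\<bar>x - xd i\<bar> \<le> - ((x $ l - xd i $ l) *\<^sub>R 1) \<longleftrightarrow> infnorm (x - xd i) = - (x - xd i) $ l"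
    using infnorm_le_neg_component_iff[of "x - xd i" l]
      abs_le_scaled_one_iff[of "x - xd i" "- (x $ l - xd i $ l)"]
    by (simp only: scaleR_minus_left vector_minus_component)
  moreover have "- (M $ \<kappa> * (x $ l - xd i $ l)) = M $ \<kappa> * - (x - xd i) $ l"
    by (simp add: algebra_simps)
  ultimately show ?thesis
    by (auto simp only: P_neg_def mem_Collect_eq prod.case)
qed

lemma mem_P_union_iff:
  "(x, z) \<in> P_union X M xd fd i \<kappa> \<longleftrightarrow>
     x \<in> X \<and> \<bar>z - fd i $ \<kappa>\<bar> \<le> M $ \<kappa> * infnorm (x - xd i)"
proof -
  \<comment> \<open>The active component and its sign select the piece that contains the pair once
    the bound on \<open>z\<close> holds.\<close>
  obtain l where "infnorm (x - xd i) = \<bar>(x - xd i) $ l\<bar>"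
    using infnorm_attained_cart by blast
  then have "infnorm (x - xd i) = (x - xd i) $ l \<or> infnorm (x - xd i) = - (x - xd i) $ l"
    by linarith
  then show ?thesis
    unfolding P_union_def by (auto simp only: UN_iff Un_iff mem_P_pos_iff mem_P_neg_iff)
qed

text \<open>A vector inequality is a conjunction over components, so the product of the sets
  \<open>Q_map\<close> collects exactly the scalar bounds of all data points.\<close>

lemma graph_F_map_eq_uncertainty_set:
  "graph_on X (F_map X M N xd fd) = uncertainty_set X M N xd fd"
  by (auto simp: graph_on_def F_map_def Q_map_def Q_set_def uncertainty_set_def
      mem_P_union_iff less_eq_vec_def abs_vec_def mult.commute)

text \<open>The same velocity serves as witness in the larger set. With singletons
  \<open>{f x}\<close> on the left, this carries trajectories of the vector field over to the
  inclusion.\<close>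

lemma solves_inclusion_mono:
  assumes "solves_inclusion X F a b \<phi>" and "\<And>x. x \<in> X \<Longrightarrow> F x \<subseteq> G x"
  shows "solves_inclusion X G a b \<phi>"
proof -
  have sol: "AE t in lebesgue. t \<in> {a..b} \<longrightarrow> (\<exists>v\<in>F (\<phi> t). (\<phi> has_vector_derivative v) (at t))"
    and X: "\<forall>t\<in>{a..b}. \<phi> t \<in> X"
    using assms(1) by (simp_all add: solves_inclusion_def)
  from sol have "AE t in lebesgue. t \<in> {a..b} \<longrightarrow> (\<exists>v\<in>G (\<phi> t). (\<phi> has_vector_derivative v) (at t))"
  proof (rule AE_mp, intro AE_I2 impI)
    fix t
    assume "t \<in> {a..b} \<longrightarrow> (\<exists>v\<in>F (\<phi> t). (\<phi> has_vector_derivative v) (at t))" and "t \<in> {a..b}"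
    \<comment> \<open>The inclusion of values is known only on \<open>X\<close>, where the curve
      stays during \<open>{a..b}\<close>.\<close>
    with X assms(2) show "\<exists>v\<in>G (\<phi> t). (\<phi> has_vector_derivative v) (at t)"
      by blast
  qed
  then show ?thesis
    using assms(1) by (simp add: solves_inclusion_def)
qed

text \<open>By the Riesz representation, \<open>g\<close> is the inner product with
  \<open>adjoint g 1\<close>.\<close>

lemma polyhedron_linear_le:
  fixes g :: "'a::euclidean_space \<Rightarrow> real"
  assumes "linear g"
  shows "polyhedron {x. g x \<le> c}"
proof -
  have "g x = adjoint g 1 \<bullet> x" for x
    using adjoint_works[OF assms, of x 1] by (simp add: inner_commute)
  then show ?thesis
    by (simp add: polyhedron_halfspace_le)
qed

lemma polyhedron_INT:
  "finite I \<Longrightarrow> (\<And>i. i \<in> I \<Longrightarrow> polyhedron (A i)) \<Longrightarrow> polyhedron (\<Inter>i\<in>I. A i)"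
  by (intro polyhedron_Inter) auto

text \<open>Preimages commute with intersections, and a half-space pulls back to a sublevel set of
  the linear functional \<open>\<lambda>x. a \<bullet> g x\<close>.\<close>

lemma polyhedron_linear_vimage:
  fixes g :: "'a::euclidean_space \<Rightarrow> 'b::euclidean_space"
  assumes "linear g" and "polyhedron S"
  shows "polyhedron (g -` S)"
proof -
  obtain H where H: "finite H" "S = \<Inter>H" "\<forall>h\<in>H. \<exists>a b. a \<noteq> 0 \<and> h = {x. a \<bullet> x \<le> b}"
    using assms(2) by (auto simp: polyhedron_def)
  have "polyhedron (g -` h)" if "h \<in> H" for h
  proof -
    obtain a b where "h = {x. a \<bullet> x \<le> b}"
      using H(3) \<open>h \<in> H\<close> by blast
    moreover have "linear (\<lambda>x. a \<bullet> g x)"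
      using linear_compose[OF assms(1) bounded_linear.linear[OF bounded_linear_inner_right, of a]]
      by (simp add: o_def)
    ultimately show ?thesis
      using polyhedron_linear_le[of "\<lambda>x. a \<bullet> g x" b] by simp
  qed
  moreover have "g -` S = \<Inter>((-`) g ` H)"
    using H(2) by blast
  ultimately show ?thesis
    using H(1) by (auto intro: polyhedron_INT)
qed

text \<open>The absolute value splits into two linear inequalities. The constants \<open>c\<close>
  and \<open>d\<close> absorb the offsets coming from the data, so that \<open>g\<close> and
  \<open>h\<close> stay linear.\<close>

lemma polyhedron_abs_le:
  fixes g h :: "'a::euclidean_space \<Rightarrow> real"
  assumes "linear g" and "linear h"
  shows "polyhedron {x. \<bar>g x - c\<bar> \<le> h x - d}"
proof -
  have "{x. \<bar>g x - c\<bar> \<le> h x - d} = {x. g x - h x \<le> c - d} \<inter> {x. - g x - h x \<le> - c - d}"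
    by auto
  moreover have "linear (\<lambda>x. g x - h x)" "linear (\<lambda>x. - g x - h x)"
    using assms by (auto intro!: linear_compose_sub linear_compose_neg)
  ultimately show ?thesis
    by (simp only: polyhedron_Int polyhedron_linear_le)
qed

lemma polyhedron_P_pos:
  assumes "polyhedron X"
  shows "polyhedron (P_pos X M xd fd i \<kappa> l)"
proof -
  have "P_pos X M xd fd i \<kappa> l = fst -` X
      \<inter> (\<Inter>j. {p. \<bar>fst p $ j - xd i $ j\<bar> \<le> fst p $ l - xd i $ l})
      \<inter> {p. \<bar>snd p - fd i $ \<kappa>\<bar> \<le> M $ \<kappa> * fst p $ l - M $ \<kappa> * xd i $ l}"
    by (auto simp: P_pos_def less_eq_vec_def abs_vec_def algebra_simps)
  moreover have "linear (\<lambda>p :: (real ^ 'a) \<times> real. fst p $ j)"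
      "linear (\<lambda>p :: (real ^ 'a) \<times> real. M $ \<kappa> * fst p $ j)" for j
    by (auto intro!: linearI simp: algebra_simps)
  ultimately show ?thesis
    by (simp only:) (intro polyhedron_Int polyhedron_INT polyhedron_linear_vimage polyhedron_abs_le
        linear_fst linear_snd assms finite)
qed

lemma polyhedron_P_neg:
  assumes "polyhedron X"
  shows "polyhedron (P_neg X M xd fd i \<kappa> l)"
proof -
  \<comment> \<open>The double negations keep each right-hand side in the form
    \<open>h x - d\<close> with \<open>h\<close> linear.\<close>
  have "P_neg X M xd fd i \<kappa> l = fst -` X
      \<inter> (\<Inter>j. {p. \<bar>fst p $ j - xd i $ j\<bar> \<le> - fst p $ l - (- xd i $ l)})
      \<inter> {p. \<bar>snd p - fd i $ \<kappa>\<bar> \<le> - (M $ \<kappa>) * fst p $ l - (- (M $ \<kappa>) * xd i $ l)}"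
    by (auto simp: P_neg_def less_eq_vec_def abs_vec_def algebra_simps)
  moreover have "linear (\<lambda>p :: (real ^ 'a) \<times> real. fst p $ j)"
      "linear (\<lambda>p :: (real ^ 'a) \<times> real. - fst p $ j)"
      "linear (\<lambda>p :: (real ^ 'a) \<times> real. - (M $ \<kappa>) * fst p $ j)" for j
    by (auto intro!: linearI simp: algebra_simps)
  ultimately show ?thesis
    by (simp only:) (intro polyhedron_Int polyhedron_INT polyhedron_linear_vimage polyhedron_abs_le
        linear_fst linear_snd assms finite)
qed

definition finite_union_of_polyhedra :: "'a::euclidean_space set \<Rightarrow> bool" where
  "finite_union_of_polyhedra S \<longleftrightarrow> (\<exists>\<P>. finite \<P> \<and> (\<forall>P\<in>\<P>. polyhedron P) \<and> S = \<Union>\<P>)"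

lemma polyhedron_imp_finite_union: "polyhedron S \<Longrightarrow> finite_union_of_polyhedra S"
  unfolding finite_union_of_polyhedra_def by (intro exI[of _ "{S}"]) auto

lemma finite_union_of_polyhedra_UN:
  assumes "finite I" and "\<And>i. i \<in> I \<Longrightarrow> polyhedron (A i)"
  shows "finite_union_of_polyhedra (\<Union>i\<in>I. A i)"
  unfolding finite_union_of_polyhedra_def using assms by (intro exI[of _ "A ` I"]) auto

text \<open>Intersection distributes over unions, so the pairwise intersections of the two families
  form the new finite family.\<close>

lemma finite_union_of_polyhedra_Int:
  assumes "finite_union_of_polyhedra S" and "finite_union_of_polyhedra T"
  shows "finite_union_of_polyhedra (S \<inter> T)"
proof -
  obtain \<P> \<Q> where "finite \<P>" "\<forall>P\<in>\<P>. polyhedron P" "S = \<Union>\<P>"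
    and "finite \<Q>" "\<forall>Q\<in>\<Q>. polyhedron Q" "T = \<Union>\<Q>"
    using assms by (auto simp: finite_union_of_polyhedra_def)
  then have "finite_union_of_polyhedra (\<Union>(P, Q)\<in>\<P> \<times> \<Q>. P \<inter> Q)"
    by (intro finite_union_of_polyhedra_UN) auto
  moreover have "(\<Union>(P, Q)\<in>\<P> \<times> \<Q>. P \<inter> Q) = S \<inter> T"
    using \<open>S = \<Union>\<P>\<close> \<open>T = \<Union>\<Q>\<close> by auto
  ultimately show ?thesis
    by simp
qed

lemma finite_union_of_polyhedra_INT:
  assumes "finite I" and "\<And>i. i \<in> I \<Longrightarrow> finite_union_of_polyhedra (A i)"
  shows "finite_union_of_polyhedra (\<Inter>i\<in>I. A i)"
  using assms
  \<comment> \<open>The empty intersection is the whole space, itself a polyhedron.\<close>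
  by (induction I rule: finite_induct)
    (auto intro: finite_union_of_polyhedra_Int polyhedron_imp_finite_union)

lemma finite_union_of_polyhedra_linear_vimage:
  assumes "linear g" and "finite_union_of_polyhedra S"
  shows "finite_union_of_polyhedra (g -` S)"
proof -
  obtain \<P> where \<P>: "finite \<P>" "\<forall>P\<in>\<P>. polyhedron P" "S = \<Union>\<P>"
    using assms(2) by (auto simp: finite_union_of_polyhedra_def)
  then have "finite_union_of_polyhedra (\<Union>P\<in>\<P>. g -` P)"
    by (intro finite_union_of_polyhedra_UN) (auto intro: polyhedron_linear_vimage assms(1))
  with \<P>(3) show ?thesis
    by (simp add: vimage_Union)
qed

lemma finite_union_of_polyhedra_P_union:
  assumes "polyhedron X"
  shows "finite_union_of_polyhedra (P_union X M xd fd i \<kappa>)"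
proof -
  \<comment> \<open>Indexing by the pieces themselves merges both signs into one finite
    family.\<close>
  have "P_union X M xd fd i \<kappa> =
      (\<Union>P\<in>range (P_pos X M xd fd i \<kappa>) \<union> range (P_neg X M xd fd i \<kappa>). P)"
    by (auto simp: P_union_def)
  also have "finite_union_of_polyhedra \<dots>"
    by (rule finite_union_of_polyhedra_UN) (auto intro: polyhedron_P_pos polyhedron_P_neg assms)
  finally show ?thesis .
qed

lemma finite_union_of_polyhedra_graph_F_map:
  assumes "polyhedron X"
  shows "finite_union_of_polyhedra (graph_on X (F_map X M N xd fd))"
proof -
  \<comment> \<open>The constraint that the state lies in \<open>X\<close> is listed separately,
    since for \<open>N = 0\<close> the intersection over \<open>i\<close> is the whole
    space.\<close>
  have "graph_on X (F_map X M N xd fd) =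
      fst -` X \<inter> (\<Inter>\<kappa>. \<Inter>i\<in>{1..N}. (\<lambda>p. (fst p, snd p $ \<kappa>)) -` P_union X M xd fd i \<kappa>)"
    by (auto simp: graph_on_def F_map_def Q_map_def Q_set_def)
  moreover have "linear (\<lambda>p :: (real ^ 'a) \<times> (real ^ 'a). (fst p, snd p $ \<kappa>))" for \<kappa>
    by (auto intro!: linearI)
  ultimately show ?thesis
    by (simp only:) (intro finite_union_of_polyhedra_Int finite_union_of_polyhedra_INT
        finite_union_of_polyhedra_linear_vimage finite_union_of_polyhedra_P_union
        polyhedron_imp_finite_union linear_fst assms finite finite_atLeastAtMost)
qed

theorem proposition1:
  fixes X :: "(real ^ 'n) set"
    and f :: "real ^ 'n \<Rightarrow> real ^ 'n"
    and M :: "real ^ 'n"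
    and N :: nat
    and xd fd :: "nat \<Rightarrow> real ^ 'n"
  assumes "convex X" and "compact X" and "polyhedron X"
    and "\<forall>\<kappa>. M $ \<kappa> > 0"
    and "\<forall>x\<in>X. \<forall>y\<in>X. \<bar>f x - f y\<bar> \<le> infnorm (x - y) *\<^sub>R M"
    and "N \<ge> 1"
    and "\<forall>i\<in>{1..N}. xd i \<in> X"
    and "\<forall>i\<in>{1..N}. fd i = f (xd i)"
  shows "graph_on X (F_map X M N xd fd) = uncertainty_set X M N xd fd
    \<and> (\<forall>a b \<phi>. a < b \<and> solves_inclusion X (\<lambda>x. {f x}) a b \<phi>
          \<longrightarrow> solves_inclusion X (F_map X M N xd fd) a b \<phi>)
    \<and> (\<exists>\<P>. finite \<P> \<and> (\<forall>P\<in>\<P>. polyhedron P) \<and> graph_on X (F_map X M N xd fd) = \<Union>\<P>)"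
proof (intro conjI allI impI)
  show graph: "graph_on X (F_map X M N xd fd) = uncertainty_set X M N xd fd"
    by (rule graph_F_map_eq_uncertainty_set)
  \<comment> \<open>The Lipschitz bound between \<open>x\<close> and each \<open>xd i\<close> is
    exactly the constraint on \<open>f x\<close>, because \<open>fd i = f (xd i)\<close>.\<close>
  have "(x, f x) \<in> uncertainty_set X M N xd fd" if "x \<in> X" for x
    using assms that by (auto simp: uncertainty_set_def)
  then have "{f x} \<subseteq> F_map X M N xd fd x" if "x \<in> X" for x
    using that by (auto simp: graph[symmetric] graph_on_def)
  then show "solves_inclusion X (F_map X M N xd fd) a b \<phi>"
    if "a < b \<and> solves_inclusion X (\<lambda>x. {f x}) a b \<phi>" for a b \<phi>
    using that solves_inclusion_mono by blast
  show "\<exists>\<P>. finite \<P> \<and> (\<forall>P\<in>\<P>. polyhedron P) \<and> graph_on X (F_map X M N xd fd) = \<Union>\<P>"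
    using finite_union_of_polyhedra_graph_F_map[OF assms(3)]
    unfolding finite_union_of_polyhedra_def .
qed

end
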